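(* Let $k\ge 1$ and $j$ be integers such that $0\le j\le k$. Define $$S_{k,0}=\sum_{n_1=1}^{\infty}\cdots\sum_{n_k=1}^{\infty}\frac{1}{(n_1+\cdots+n_k)!},\qquad S_{k,j}=\sum_{n_1=1}^{\infty}\cdots\sum_{n_k=1}^{\infty}\frac{n_1\cdots n_j}{(n_1+\cdots+n_k)!}\quad(1\le j\le k),$$ and, for integers $\ell\ge 0$, $\exp_\ell(z)=\sum_{n=0}^{\infty}\frac{z^n}{(n+\ell)!}$. Then $$S_{k,j}=\frac{1}{(k+j-1)!}\left.\left[\left(\frac{d}{dz}\right)^{k+j-1}\bigl(z^{k-1}\exp_{k-j}(z)\bigr)\right]\right|_{z=1}.$$ *)

theory Defs
  imports "HOL-Analysis.Analysis"
begin

text \<open>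
  The \<open>k\<close>-fold iterated series over positive integers
  \<open>\<Sum>n\<^sub>1\<ge>1. \<dots> \<Sum>n\<^sub>k\<ge>1. f [n\<^sub>1, \<dots>, n\<^sub>k]\<close>; the head of the list belongs to the outermost series,
  and \<^term>\<open>Suc n\<close> makes each index start at 1. Since \<^const>\<open>suminf\<close> is unspecified for
  divergent series, convergence at every level is a separate predicate.
\<close>

primrec iterated_suminf :: "nat \<Rightarrow> (nat list \<Rightarrow> real) \<Rightarrow> real" where
  "iterated_suminf 0 f = f []"
| "iterated_suminf (Suc k) f = (\<Sum>n. iterated_suminf k (\<lambda>ns. f (Suc n # ns)))"

primrec iterated_summable :: "nat \<Rightarrow> (nat list \<Rightarrow> real) \<Rightarrow> bool" where
  "iterated_summable 0 f \<longleftrightarrow> True"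
| "iterated_summable (Suc k) f \<longleftrightarrow>
     (\<forall>n. iterated_summable k (\<lambda>ns. f (Suc n # ns))) \<and>
     summable (\<lambda>n. iterated_suminf k (\<lambda>ns. f (Suc n # ns)))"

text \<open>List positions count from 0, so \<open>ns ! i\<close> is \<open>n\<^sub>i\<^sub>+\<^sub>1\<close>. For \<open>j = 0\<close> the numerator is the
  empty product 1.\<close>

definition S_term :: "nat \<Rightarrow> nat \<Rightarrow> nat list \<Rightarrow> real" where
  "S_term k j ns = (\<Prod>i<j. real (ns ! i)) / fact (\<Sum>i<k. ns ! i)"

definition S :: "nat \<Rightarrow> nat \<Rightarrow> real" where
  "S k j = iterated_suminf k (S_term k j)"

definition exp_sub :: "nat \<Rightarrow> complex \<Rightarrow> complex" where
  "exp_sub l z = (\<Sum>n. z ^ n / fact (n + l))"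

end

theory Submission
  imports Defs
begin

text \<open>
  Grouping the terms by \<open>N = n\<^sub>1 + \<dots> + n\<^sub>k\<close>, the sum of \<open>n\<^sub>1 \<cdots> n\<^sub>j\<close> over all compositions of
  \<open>m + k\<close> into \<open>k\<close> positive parts is the coefficient of \<open>x\<^sup>m\<close> in \<open>(1 - x)\<close> to the power
  \<open>-(k + j)\<close>, that is \<open>(m + k + j - 1) choose m\<close>. Since all terms are nonnegative, the iterated
  series equals \<open>\<Sum>m. ((m + k + j - 1) choose m) / (m + k)!\<close>, which is also what termwise
  differentiation of the entire power series of \<open>z^(k - 1) * exp_sub (k - j) z\<close> yields.
\<close>

text \<open>Tonelli: for nonnegative terms, convergence of the diagonal sums gives unconditional
  summability over the triangle of pairs \<open>(N, m)\<close> with \<open>m \<le> N\<close>. The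
  bijection \<open>(n, m) \<mapsto> (n + m, m)\<close> carries this to the full quadrant, which is
  then summed row by row.\<close>

lemma nonneg_diagonal_sums_imp_iterated_sums:
  fixes a :: "nat \<Rightarrow> nat \<Rightarrow> real"
  assumes nonneg: "\<And>n m. 0 \<le> a n m"
    and diag: "(\<lambda>N. \<Sum>m\<le>N. a (N - m) m) sums s"
  shows "summable (a n)" and "(\<lambda>n. \<Sum>m. a n m) sums s"
proof -
  let ?D = "SIGMA N:UNIV. {..N::nat}"
  let ?d = "\<lambda>(N, m). a (N - m) m"
  have row: "((\<lambda>m. ?d (N, m)) has_sum (\<Sum>m\<le>N. a (N - m) m)) {..N}" for N
    by (simp add: has_sum_finite)
  have tot: "((\<lambda>N. \<Sum>m\<le>N. a (N - m) m) has_sum s) UNIV"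
    using diag by (intro sums_nonneg_imp_has_sum) (auto intro: sum_nonneg nonneg)
  have "?d summable_on ?D"
    by (rule summable_on_SigmaI[OF row]) (use tot nonneg in \<open>auto simp: summable_on_def\<close>)
  then have "(?d has_sum s) ?D"
    by (intro has_sum_SigmaI[OF row tot])
  moreover have "bij_betw (\<lambda>(n, m). (n + m, m)) (UNIV \<times> UNIV) ?D"
    by (rule bij_betwI[where g = "\<lambda>(N, m). (N - m, m)"]) auto
  ultimately have "((\<lambda>p. ?d (case p of (n, m) \<Rightarrow> (n + m, m))) has_sum s) (UNIV \<times> UNIV)"
    using has_sum_reindex_bij_betw by blast
  then have prod: "((\<lambda>(n, m). a n m) has_sum s) (UNIV \<times> UNIV)"
    by (simp add: case_prod_unfold)
  then have on: "(a n) summable_on UNIV" for n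
    using summable_on_SigmaD1[of "\<lambda>n m. a n m" UNIV "\<lambda>_. UNIV" n]
    by (auto simp: summable_on_def)
  show summ: "summable (a n)" for n
    using on by (rule summable_on_imp_summable)
  have "(a n has_sum (\<Sum>m. a n m)) UNIV" for n
    using summ by (intro sums_nonneg_imp_has_sum summable_sums) (auto simp: nonneg)
  then have "((\<lambda>n. \<Sum>m. a n m) has_sum s) UNIV"
    using has_sum_SigmaD[OF prod] by simp
  then show "(\<lambda>n. \<Sum>m. a n m) sums s"
    by (rule has_sum_imp_sums)
qed

text \<open>For \<open>r = 0\<close> truncated subtraction makes \<open>(m + r - 1) choose m\<close> equal to 1 at \<open>m = 0\<close> and
  to 0 elsewhere, which is the right coefficient sequence of the constant series 1.\<close>

lemma sum_multichoose:
  "(\<Sum>m\<le>N. (m + r - 1) choose m) = (N + r) choose N"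
proof (induction N)
  case (Suc N)
  then show ?case by (simp add: add.commute)
qed simp

text \<open>Cauchy product of \<open>(1 - x)\<close> to the powers \<open>-2\<close> and
  \<open>-r\<close>. In the induction, raising \<open>N\<close> by one raises every weight by 1, so
  the increment is an unweighted sum.\<close>

lemma sum_weighted_multichoose:
  "(\<Sum>m\<le>N. Suc (N - m) * ((m + r - 1) choose m)) = Suc (N + r) choose N"
proof (induction N)
  case (Suc N)
  have "(\<Sum>m\<le>Suc N. Suc (Suc N - m) * ((m + r - 1) choose m)) =
      (\<Sum>m\<le>N. Suc (N - m) * ((m + r - 1) choose m)) + (\<Sum>m\<le>Suc N. (m + r - 1) choose m)"
    by (simp add: Suc_diff_le sum.distrib flip: add.assoc)
  also have "\<dots> = Suc (Suc N + r) choose Suc N"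
    unfolding Suc.IH sum_multichoose by simp
  finally show ?case .
qed simp

text \<open>Induction on \<open>k\<close> peels off the outermost index. A general \<open>g\<close>
  replaces the reciprocal factorial because fixing that index shifts and scales
  \<open>g\<close>.\<close>

lemma iterated_suminf_compositions:
  fixes g :: "nat \<Rightarrow> real"
  assumes "j \<le> k" and "\<And>n. 0 \<le> g n"
    and "summable (\<lambda>m. real ((m + (k + j) - 1) choose m) * g (m + k))"
  defines "f \<equiv> \<lambda>ns. (\<Prod>i<j. real (ns ! i)) * g (\<Sum>i<k. ns ! i)"
  shows "iterated_summable k f \<and>
    iterated_suminf k f = (\<Sum>m. real ((m + (k + j) - 1) choose m) * g (m + k))"
  using assms(1-3) unfolding f_def
proof (induction k arbitrary: j g)
  case 0
  have "(\<Sum>m. real ((m - 1) choose m) * g m) = (\<Sum>m\<in>{0}. real ((m - 1) choose m) * g m)"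
    by (rule suminf_finite) auto
  then show ?case using 0 by simp
next
  case (Suc k)
  \<comment> \<open>The numerator factor contributed by the outermost index \<open>Suc n\<close>;
    \<open>j'\<close> counts the factors left for the inner indices.\<close>
  define w :: "nat \<Rightarrow> nat" where "w n = (if j = 0 then 1 else Suc n)" for n
  define j' where "j' = j - 1"
  define c where "c m = (m + (k + j') - 1) choose m" for m
  define h where "h n N = real (w n) * g (Suc n + N)" for n N
  have j': "j' \<le> k" using Suc.prems(1) by (simp add: j'_def)
  have h_nonneg: "0 \<le> h n N" for n N
    using Suc.prems(2) by (simp add: h_def)
  \<comment> \<open>The exponent \<open>k + j'\<close> grows by 1 if \<open>j = 0\<close> and by 2
    otherwise, reaching \<open>Suc k + j\<close> either way.\<close>
  have conv: "(\<Sum>m\<le>N. w (N - m) * c m) = (N + (Suc k + j) - 1) choose N" for N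
  proof (cases "j = 0")
    case True
    then show ?thesis
      using sum_multichoose[of "k + j'" N] by (simp add: w_def c_def j'_def)
  next
    case False
    then show ?thesis
      using sum_weighted_multichoose[of N "k + j'"] by (simp add: w_def c_def j'_def)
  qed
  define a where "a n m = real (c m) * h n (m + k)" for n m
  have a_nonneg: "0 \<le> a n m" for n m
    by (simp add: a_def h_nonneg)
  \<comment> \<open>On a diagonal the argument of \<open>g\<close> is constantly
    \<open>N + Suc k\<close>, so only the weights are summed.\<close>
  have "(\<Sum>m\<le>N. a (N - m) m) = real ((N + (Suc k + j) - 1) choose N) * g (N + Suc k)" for N
  proof -
    have "(\<Sum>m\<le>N. a (N - m) m) = (\<Sum>m\<le>N. real (w (N - m) * c m) * g (N + Suc k))"
      by (rule sum.cong) (simp_all add: a_def h_def)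
    also have "\<dots> = real (\<Sum>m\<le>N. w (N - m) * c m) * g (N + Suc k)"
      by (simp add: sum_distrib_right)
    finally show ?thesis by (simp only: conv)
  qed
  then have "(\<lambda>N. \<Sum>m\<le>N. a (N - m) m) sums
      (\<Sum>N. real ((N + (Suc k + j) - 1) choose N) * g (N + Suc k))"
    using Suc.prems(3) by (simp only: summable_sums)
  note a = nonneg_diagonal_sums_imp_iterated_sums[OF a_nonneg this]
  have split: "(\<Prod>i<j. real ((Suc n # ns) ! i)) * g (\<Sum>i<Suc k. (Suc n # ns) ! i) =
      (\<Prod>i<j'. real (ns ! i)) * h n (\<Sum>i<k. ns ! i)" for n ns
    unfolding sum.lessThan_Suc_shift
    by (cases j) (simp_all add: h_def w_def j'_def prod.lessThan_Suc_shift del: prod.lessThan_Suc)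
  \<comment> \<open>Row summability \<open>a(1)\<close> supplies the convergence hypothesis of the
    induction hypothesis for \<open>h n\<close>.\<close>
  have "iterated_summable k (\<lambda>ns. (\<Prod>i<j'. real (ns ! i)) * h n (\<Sum>i<k. ns ! i)) \<and>
      iterated_suminf k (\<lambda>ns. (\<Prod>i<j'. real (ns ! i)) * h n (\<Sum>i<k. ns ! i)) = (\<Sum>m. a n m)" for n
    using Suc.IH[of j' "h n", OF j' h_nonneg] a(1)[of n] by (simp add: a_def[abs_def] c_def)
  then show ?case
    using a(2) by (simp only: iterated_summable.simps iterated_suminf.simps split)
      (auto simp: sums_iff)
qed

lemma funpow_diffs: "(diffs ^^ r) a n = fact (n + r) / fact n * a (n + r)"
  for a :: "nat \<Rightarrow> complex"
proof (induction r arbitrary: n)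
  case (Suc r)
  have "(diffs ^^ Suc r) a n = of_nat (Suc n) * (fact (Suc n + r) / fact (Suc n) * a (Suc n + r))"
    by (simp add: diffs_def Suc.IH)
  also have "\<dots> = fact (n + Suc r) / fact n * a (n + Suc r)"
    by (simp add: field_simps del: of_nat_Suc)
  finally show ?case .
qed simp

text \<open>Summability is carried through the induction because each further termwise
  differentiation needs convergence everywhere.\<close>

lemma funpow_deriv_power_series:
  fixes a :: "nat \<Rightarrow> complex"
  assumes "\<And>z. summable (\<lambda>n. a n * z ^ n)"
  shows "summable (\<lambda>n. (diffs ^^ r) a n * z ^ n) \<and>
    (deriv ^^ r) (\<lambda>z. \<Sum>n. a n * z ^ n) z = (\<Sum>n. (diffs ^^ r) a n * z ^ n)"
proof (induction r arbitrary: z)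
  case (Suc r)
  then have summ: "summable (\<lambda>n. (diffs ^^ r) a n * z ^ n)" for z
    by blast
  have "(deriv ^^ r) (\<lambda>z. \<Sum>n. a n * z ^ n) = (\<lambda>z. \<Sum>n. (diffs ^^ r) a n * z ^ n)"
    using Suc.IH by blast
  then have "(deriv ^^ Suc r) (\<lambda>z. \<Sum>n. a n * z ^ n) z = (\<Sum>n. diffs ((diffs ^^ r) a) n * z ^ n)"
    using termdiffs_strong_converges_everywhere[OF summ] by (simp add: DERIV_imp_deriv)
  then show ?case
    using termdiff_converges_all[OF summ] by simp
qed (use assms in simp)

lemma summable_power_over_fact_add: "summable (\<lambda>n. z ^ n / fact (n + l))" for z :: complex
proof (rule summable_comparison_test)
  show "\<exists>N. \<forall>n\<ge>N. norm (z ^ n / fact (n + l)) \<le> norm z ^ n / fact n"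
    by (auto simp: norm_divide norm_power intro!: divide_left_mono fact_mono)
  show "summable (\<lambda>n. norm z ^ n / fact n)"
    using summable_exp[of "norm z"] by (simp add: field_simps)
qed

lemma funpow_deriv_power_mult_exp_sub:
  assumes "k \<ge> 1" and "j \<le> k"
  shows "(\<lambda>m. complex_of_real (real ((m + (k + j) - 1) choose m) * (1 / fact (m + k)))) sums
    (1 / fact (k + j - 1) *
      (deriv ^^ (k + j - 1)) (\<lambda>z. z ^ (k - 1) * exp_sub (k - j) z) 1)"
proof -
  define r where "r = k + j - 1"
  \<comment> \<open>Taylor coefficients of \<open>z ^ (k - 1) * exp_sub (k - j) z\<close>:
    \<open>n - (k - 1) + (k - j)\<close> equals \<open>n + 1 - j\<close>, and
    \<open>j \<le> k\<close> keeps the subtraction from truncating once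
    \<open>n \<ge> k - 1\<close>.\<close>
  define a :: "nat \<Rightarrow> complex" where "a n = (if n < k - 1 then 0 else 1 / fact (n + 1 - j))" for n
  have "(\<lambda>n. a n * z ^ n) sums (z ^ (k - 1) * exp_sub (k - j) z)" for z
  proof -
    have "(\<lambda>n. z ^ (k - 1) * (z ^ n / fact (n + (k - j)))) sums (z ^ (k - 1) * exp_sub (k - j) z)"
      unfolding exp_sub_def by (intro sums_mult summable_sums summable_power_over_fact_add)
    moreover have "z ^ (k - 1) * (z ^ n / fact (n + (k - j))) =
        a (n + (k - 1)) * z ^ (n + (k - 1))" for n
    proof -
      have "n + (k - 1) + 1 - j = n + (k - j)" using assms by simp
      then show ?thesis unfolding a_def by (simp add: power_add)
    qed
    ultimately have "(\<lambda>n. a (n + (k - 1)) * z ^ (n + (k - 1))) sums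
        (z ^ (k - 1) * exp_sub (k - j) z)"
      by simp
    then show ?thesis
      by (subst (asm) sums_zero_iff_shift) (auto simp: a_def)
  qed
  then have summ: "\<And>z. summable (\<lambda>n. a n * z ^ n)"
    and fn: "(\<lambda>z. z ^ (k - 1) * exp_sub (k - j) z) = (\<lambda>z. \<Sum>n. a n * z ^ n)"
    by (auto simp: sums_iff)
  have "(diffs ^^ r) a sums (deriv ^^ r) (\<lambda>z. z ^ (k - 1) * exp_sub (k - j) z) 1"
    unfolding fn using funpow_deriv_power_series[OF summ, of r 1] by (simp add: sums_iff)
  then have "(\<lambda>m. 1 / fact r * (diffs ^^ r) a m) sums
      (1 / fact r * (deriv ^^ r) (\<lambda>z. z ^ (k - 1) * exp_sub (k - j) z) 1)"
    by (rule sums_mult)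
  \<comment> \<open>Since \<open>m + r \<ge> k - 1\<close>, only the nonzero branch of
    \<open>a\<close> occurs; dividing by \<open>fact r\<close> turns the falling factorial into a
    binomial coefficient.\<close>
  moreover have "1 / fact r * (diffs ^^ r) a m =
      complex_of_real (real ((m + (k + j) - 1) choose m) * (1 / fact (m + k)))" for m
  proof -
    have "m + r + 1 - j = m + k" "\<not> m + r < k - 1" and idx: "m + (k + j) - 1 = m + r"
      using assms by (auto simp: r_def)
    then have "1 / fact r * (diffs ^^ r) a m = fact (m + r) / (fact m * fact r) * (1 / fact (m + k))"
      unfolding funpow_diffs a_def by simp
    moreover have "complex_of_nat ((m + r) choose m) = fact (m + r) / (fact m * fact r)"
      using binomial_fact[of m "m + r", where 'a = complex] by simp
    ultimately show ?thesis unfolding idx by simp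
  qed
  ultimately show ?thesis by (simp add: r_def)
qed

theorem theorem3:
  fixes k j :: nat
  assumes "k \<ge> 1" and "j \<le> k"
  shows "iterated_summable k (S_term k j) \<and>
    complex_of_real (S k j) =
      1 / fact (k + j - 1) *
      (deriv ^^ (k + j - 1)) (\<lambda>z. z ^ (k - 1) * exp_sub (k - j) z) 1"
proof -
  let ?t = "\<lambda>m. real ((m + (k + j) - 1) choose m) * (1 / fact (m + k))"
  note series = funpow_deriv_power_mult_exp_sub[OF assms]
  \<comment> \<open>Convergence of the real series is inherited from the complex power series at
    1.\<close>
  have summ: "summable ?t"
    using sums_summable[OF series] by (simp only: summable_complex_of_real)
  have "S_term k j = (\<lambda>ns. (\<Prod>i<j. real (ns ! i)) * (1 / fact (\<Sum>i<k. ns ! i)))"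
    by (simp add: S_term_def fun_eq_iff)
  then have "iterated_summable k (S_term k j) \<and> S k j = (\<Sum>m. ?t m)"
    using iterated_suminf_compositions[OF assms(2) _ summ] by (simp add: S_def)
  moreover have "(\<lambda>m. complex_of_real (?t m)) sums complex_of_real (\<Sum>m. ?t m)"
    using summ by (intro sums_of_real summable_sums)
  ultimately show ?thesis
    using sums_unique2[OF _ series] by simp
qed

end
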